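(* Let $S$ be an additively idempotent semiring. A $k$-ideal $I$ of $S$ is $k$-prime if and only if for all $x,y\in S$ and $z\in I$, $xy\leqslant z$ implies $x\in I$ or $y\in I$.
   Context: A semiring is a commutative semiring $(S,+,0,\cdot,1)$ with multiplicative identity $1$ and additive identity $0$ that is absorbing. It is additively idempotent if $x+x=x$ for all $x$; then the natural partial order is $x\leqslant y\iff x+y=y$. An ideal is a nonempty subset closed under addition and under multiplication by elements of $S$. A $k$-ideal is an ideal $I$ such that $x+y\in I$ and $y\in I$ imply $x\in I$. A $k$-ideal $I$ is $k$-prime if for all $k$-ideals $A,B$, $AB\subseteq I$ implies $A\subseteq I$ or $B\subseteq I$, where $AB$ is the ideal of finite sums of products $ab$ with $a\in A$, $b\in B$. *)

theory Defs imports Main begin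

text \<open>
  A commutative semiring with absorbing 0 and identity 1 is a type of sort
  {comm_semiring_0, comm_monoid_mult}. The class comm_semiring_1 is not used because it
  includes the axiom that 0 and 1 are distinct, which would exclude the one-element semiring.
\<close>

definition additively_idempotent :: "'a::{comm_semiring_0, comm_monoid_mult} itself \<Rightarrow> bool" where
  "additively_idempotent _ \<longleftrightarrow> (\<forall>x::'a. x + x = x)"

definition natural_le :: "'a::{comm_semiring_0, comm_monoid_mult} \<Rightarrow> 'a \<Rightarrow> bool"
    (infix "\<preceq>" 50) where
  "x \<preceq> y \<longleftrightarrow> x + y = y"

definition semiring_ideal :: "'a::{comm_semiring_0, comm_monoid_mult} set \<Rightarrow> bool" where
  "semiring_ideal I \<longleftrightarrow>
     I \<noteq> {} \<and> (\<forall>x\<in>I. \<forall>y\<in>I. x + y \<in> I) \<and> (\<forall>s. \<forall>x\<in>I. s * x \<in> I)"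

definition k_ideal :: "'a::{comm_semiring_0, comm_monoid_mult} set \<Rightarrow> bool" where
  "k_ideal I \<longleftrightarrow> semiring_ideal I \<and> (\<forall>x y. x + y \<in> I \<longrightarrow> y \<in> I \<longrightarrow> x \<in> I)"

definition ideal_product ::
    "'a::{comm_semiring_0, comm_monoid_mult} set \<Rightarrow> 'a set \<Rightarrow> 'a set" where
  "ideal_product A B =
     {\<Sum>i<n. a i * b i | (n::nat) a b. \<forall>i<n. a i \<in> A \<and> b i \<in> B}"

text \<open>Properness is not part of the definition: the whole semiring is k-prime.\<close>

definition k_prime :: "'a::{comm_semiring_0, comm_monoid_mult} set \<Rightarrow> bool" where
  "k_prime I \<longleftrightarrow> k_ideal I \<and>
     (\<forall>A B. k_ideal A \<longrightarrow> k_ideal B \<longrightarrow> ideal_product A B \<subseteq> I \<longrightarrow> A \<subseteq> I \<or> B \<subseteq> I)"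

end

theory Submission imports Defs begin

text \<open>
  The colon sets \<open>(I : X) = {a. aX \<subseteq> I}\<close> of a k-ideal are k-ideals. If \<open>xy \<in> I\<close>, then
  \<open>A = (I : {y})\<close> and \<open>B = (I : A)\<close> contain \<open>x\<close> and \<open>y\<close> respectively and satisfy \<open>AB \<subseteq> I\<close>, so
  k-primeness of \<open>I\<close> is the element-wise condition \<open>xy \<in> I \<Longrightarrow> x \<in> I \<or> y \<in> I\<close>.
  Since k-ideals are downward closed, this is the condition with \<open>xy \<preceq> z \<in> I\<close>; idempotence
  allows \<open>z = xy\<close>.
\<close>

definition colon :: "'a::{comm_semiring_0, comm_monoid_mult} set \<Rightarrow> 'a set \<Rightarrow> 'a set" where
  "colon I X = {a. \<forall>x\<in>X. a * x \<in> I}"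

lemma semiring_ideal_zero:
  assumes "semiring_ideal I"
  shows "0 \<in> I"
  using assms unfolding semiring_ideal_def by (metis ex_in_conv mult_zero_left)

lemma semiring_ideal_sum:
  assumes "semiring_ideal I" and "\<And>i. i \<in> F \<Longrightarrow> f i \<in> I"
  shows "sum f F \<in> I"
  using assms(2)
proof (induction F rule: infinite_finite_induct)
  case (insert i F)
  then show ?case
    using assms(1) unfolding semiring_ideal_def by simp
qed (simp_all add: semiring_ideal_zero[OF assms(1)])

text \<open>A single product is a sum of length one; conversely, \<open>I\<close> absorbs finite
  sums, the empty one giving 0.\<close>

lemma ideal_product_subset_iff:
  assumes "semiring_ideal I"
  shows "ideal_product A B \<subseteq> I \<longleftrightarrow> (\<forall>a\<in>A. \<forall>b\<in>B. a * b \<in> I)"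
proof
  assume sub: "ideal_product A B \<subseteq> I"
  show "\<forall>a\<in>A. \<forall>b\<in>B. a * b \<in> I"
  proof (intro ballI)
    fix a b assume "a \<in> A" "b \<in> B"
    then have "(\<Sum>i<Suc 0. a * b) \<in> ideal_product A B"
      unfolding ideal_product_def
      by (intro CollectI exI[of _ "Suc 0"] exI[of _ "\<lambda>_. a"] exI[of _ "\<lambda>_. b"]) simp
    then show "a * b \<in> I" using sub by auto
  qed
next
  assume "\<forall>a\<in>A. \<forall>b\<in>B. a * b \<in> I"
  then show "ideal_product A B \<subseteq> I"
    unfolding ideal_product_def by (auto intro!: semiring_ideal_sum[OF assms])
qed

text \<open>For fixed \<open>x\<close>, the map sending \<open>a\<close> to \<open>a * x\<close> is
  additive and respects scaling, so each closure condition pulls back from \<open>I\<close>.\<close>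

lemma k_ideal_colon:
  assumes "k_ideal I"
  shows "k_ideal (colon I X)"
proof -
  have ideal: "semiring_ideal I" using assms unfolding k_ideal_def by simp
  have "0 \<in> colon I X" unfolding colon_def by (simp add: semiring_ideal_zero[OF ideal])
  moreover have "a + b \<in> colon I X" if "a \<in> colon I X" "b \<in> colon I X" for a b
    using that ideal unfolding colon_def semiring_ideal_def by (simp add: distrib_right)
  moreover have "s * a \<in> colon I X" if "a \<in> colon I X" for s a
    using that ideal unfolding colon_def semiring_ideal_def by (simp add: mult.assoc)
  moreover have "a \<in> colon I X" if "a + b \<in> colon I X" "b \<in> colon I X" for a b
    using that assms unfolding colon_def k_ideal_def by (auto simp: distrib_right)
  ultimately show ?thesis
    unfolding k_ideal_def semiring_ideal_def by blast
qed

lemma k_prime_iff_elementwise: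
  assumes "k_ideal I"
  shows "k_prime I \<longleftrightarrow> (\<forall>x y. x * y \<in> I \<longrightarrow> x \<in> I \<or> y \<in> I)"
proof -
  have ideal: "semiring_ideal I" using assms unfolding k_ideal_def by simp
  show ?thesis
  proof (intro iffI allI impI)
    fix x y assume prime: "k_prime I" and xy: "x * y \<in> I"
    let ?A = "colon I {y}"
    let ?B = "colon I ?A"
    have "ideal_product ?A ?B \<subseteq> I"
      unfolding ideal_product_subset_iff[OF ideal] by (auto simp: colon_def mult.commute)
    then have "?A \<subseteq> I \<or> ?B \<subseteq> I"
      using prime k_ideal_colon[OF assms] unfolding k_prime_def by blast
    \<comment> \<open>Every \<open>a\<close> in \<open>?A\<close> satisfies
      \<open>a * y \<in> I\<close>, which puts \<open>y\<close> into \<open>?B\<close>.\<close>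
    moreover have "x \<in> ?A" "y \<in> ?B"
      using xy by (auto simp: colon_def mult.commute)
    ultimately show "x \<in> I \<or> y \<in> I" by blast
  next
    assume "\<forall>x y. x * y \<in> I \<longrightarrow> x \<in> I \<or> y \<in> I"
    \<comment> \<open>If neither \<open>A\<close> nor \<open>B\<close> lay in \<open>I\<close>,
      elements \<open>a\<close> of \<open>A\<close> and \<open>b\<close> of \<open>B\<close> outside
      \<open>I\<close> would have their product in \<open>I\<close>.\<close>
    then show "k_prime I"
      using assms unfolding k_prime_def ideal_product_subset_iff[OF ideal] by blast
  qed
qed

text \<open>Here \<open>x + z = z\<close> lies in \<open>I\<close> along with \<open>z\<close>, so
  the k-condition cancels \<open>z\<close>.\<close>

lemma k_ideal_downward_closed:
  assumes "k_ideal I" and "z \<in> I" and "x \<preceq> z"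
  shows "x \<in> I"
  using assms unfolding k_ideal_def natural_le_def by metis

theorem theorem6p15:
  fixes I :: "'a::{comm_semiring_0, comm_monoid_mult} set"
  assumes "additively_idempotent TYPE('a)"
    and "k_ideal I"
  shows "k_prime I \<longleftrightarrow> (\<forall>x y. \<forall>z\<in>I. x * y \<preceq> z \<longrightarrow> x \<in> I \<or> y \<in> I)"
proof -
  have "x \<preceq> x" for x :: 'a
    using assms(1) unfolding additively_idempotent_def natural_le_def by simp
  then show ?thesis
    unfolding k_prime_iff_elementwise[OF assms(2)]
    using k_ideal_downward_closed[OF assms(2)] by blast
qed

end
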